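(* Let $(W,S)$ be a Coxeter system with $S$ finite and let $c\in W$ be a Coxeter element. Let $x\in[1,c]_T$ and let $t_1t_2\cdots t_k$ be a $T$-reduced expression of $x$. If $y\in[1,c]_T$ admits a $T$-reduced expression whose letters are exactly the $t_i$'s, then $x=y$.
   Context: $T=\bigcup_{w\in W} wSw^{-1}$ is the set of reflections of $W$. The reflection length $\ell_T(w)$ is the smallest $k\ge 0$ such that $w$ is a product of $k$ elements of $T$. A $T$-reduced expression of $w$ is a word $t_1t_2\cdots t_k$ in elements of $T$ with $w=t_1t_2\cdots t_k$ and $k=\ell_T(w)$. The absolute order is the partial order on $W$ defined by $u\leq_T v \iff \ell_T(u)+\ell_T(u^{-1}v)=\ell_T(v)$. A Coxeter element is a product of all the elements of $S$, each occurring exactly once, in some order. $[1,c]_T=\{x\in W\mid x\leq_T c\}$. *)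

theory Defs
  imports "HOL-Algebra.Group"
begin

text \<open>
  The letter \<open>(s, True)\<close> stands for the generator \<open>s\<close> and \<open>(s, False)\<close> for its formal inverse.
\<close>

type_synonym 'a group_word = "('a \<times> bool) list"

definition group_words :: "'a set \<Rightarrow> 'a group_word set" where
  "group_words X = lists (X \<times> UNIV)"

text \<open>
  The smallest congruence on words over \<open>X\<close> that contains the free cancellations
  and identifies every relator in \<open>R\<close> with the empty word; its classes form the group
  \<open>\<langle>X | R\<rangle>\<close>.
\<close>

inductive presentation_eq :: "'a set \<Rightarrow> 'a group_word set \<Rightarrow> 'a group_word \<Rightarrow> 'a group_word \<Rightarrow> bool"
  for X :: "'a set" and R :: "'a group_word set" where
  refl: "u \<in> group_words X \<Longrightarrow> presentation_eq X R u u"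
| sym: "presentation_eq X R u v \<Longrightarrow> presentation_eq X R v u"
| trans: "presentation_eq X R u v \<Longrightarrow> presentation_eq X R v w \<Longrightarrow> presentation_eq X R u w"
| cancel: "u \<in> group_words X \<Longrightarrow> v \<in> group_words X \<Longrightarrow> s \<in> X
    \<Longrightarrow> presentation_eq X R (u @ [(s, b), (s, \<not> b)] @ v) (u @ v)"
| relator: "u \<in> group_words X \<Longrightarrow> v \<in> group_words X \<Longrightarrow> r \<in> R
    \<Longrightarrow> presentation_eq X R (u @ r @ v) (u @ v)"

definition list_prod :: "('a, 'b) monoid_scheme \<Rightarrow> 'a list \<Rightarrow> 'a" where
  "list_prod G xs = foldr (\<otimes>\<^bsub>G\<^esub>) xs \<one>\<^bsub>G\<^esub>"

definition eval_word :: "('a, 'b) monoid_scheme \<Rightarrow> 'a group_word \<Rightarrow> 'a" where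
  "eval_word G w = list_prod G (map (\<lambda>(s, b). if b then s else inv\<^bsub>G\<^esub> s) w)"

text \<open>
  \<open>G = \<langle>X | R\<rangle>\<close> for a subset \<open>X\<close> of \<open>G\<close>: evaluation of words
  induces a bijection from the classes of \<^const>\<open>presentation_eq\<close> onto \<open>G\<close>.
\<close>

definition presented_by :: "('a, 'b) monoid_scheme \<Rightarrow> 'a set \<Rightarrow> 'a group_word set \<Rightarrow> bool" where
  "presented_by G X R \<longleftrightarrow>
     group G \<and> X \<subseteq> carrier G \<and> R \<subseteq> group_words X \<and>
     eval_word G ` group_words X = carrier G \<and>
     (\<forall>u \<in> group_words X. \<forall>v \<in> group_words X.
        eval_word G u = eval_word G v \<longleftrightarrow> presentation_eq X R u v)"

text \<open>The value \<open>0\<close> of a Coxeter matrix encodes \<open>\<infinity>\<close>.\<close>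

definition coxeter_matrix :: "'a set \<Rightarrow> ('a \<Rightarrow> 'a \<Rightarrow> nat) \<Rightarrow> bool" where
  "coxeter_matrix S m \<longleftrightarrow>
     (\<forall>s \<in> S. \<forall>t \<in> S. m s t = m t s \<and> (m s t = 1 \<longleftrightarrow> s = t))"

definition coxeter_relators :: "'a set \<Rightarrow> ('a \<Rightarrow> 'a \<Rightarrow> nat) \<Rightarrow> 'a group_word set" where
  "coxeter_relators S m =
     {concat (replicate (m s t) [(s, True), (t, True)]) | s t. s \<in> S \<and> t \<in> S \<and> m s t \<noteq> 0}"

definition coxeter_system :: "('a, 'b) monoid_scheme \<Rightarrow> 'a set \<Rightarrow> bool" where
  "coxeter_system W S \<longleftrightarrow>
     (\<exists>m. coxeter_matrix S m \<and> presented_by W S (coxeter_relators S m))"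

definition reflections :: "('a, 'b) monoid_scheme \<Rightarrow> 'a set \<Rightarrow> 'a set" where
  "reflections W S = (\<Union>w \<in> carrier W. (\<lambda>s. w \<otimes>\<^bsub>W\<^esub> s \<otimes>\<^bsub>W\<^esub> inv\<^bsub>W\<^esub> w) ` S)"

definition reflection_length :: "('a, 'b) monoid_scheme \<Rightarrow> 'a set \<Rightarrow> 'a \<Rightarrow> nat" where
  "reflection_length W S w =
     (LEAST k. \<exists>ts. set ts \<subseteq> reflections W S \<and> length ts = k \<and> list_prod W ts = w)"

definition T_reduced_expression :: "('a, 'b) monoid_scheme \<Rightarrow> 'a set \<Rightarrow> 'a \<Rightarrow> 'a list \<Rightarrow> bool" where
  "T_reduced_expression W S w ts \<longleftrightarrow>
     set ts \<subseteq> reflections W S \<and> w = list_prod W ts \<and> length ts = reflection_length W S w"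

definition absolute_le :: "('a, 'b) monoid_scheme \<Rightarrow> 'a set \<Rightarrow> 'a \<Rightarrow> 'a \<Rightarrow> bool" where
  "absolute_le W S u v \<longleftrightarrow>
     reflection_length W S u + reflection_length W S (inv\<^bsub>W\<^esub> u \<otimes>\<^bsub>W\<^esub> v) = reflection_length W S v"

definition coxeter_element :: "('a, 'b) monoid_scheme \<Rightarrow> 'a set \<Rightarrow> 'a \<Rightarrow> bool" where
  "coxeter_element W S c \<longleftrightarrow> (\<exists>ss. distinct ss \<and> set ss = S \<and> c = list_prod W ss)"

definition absolute_interval :: "('a, 'b) monoid_scheme \<Rightarrow> 'a set \<Rightarrow> 'a \<Rightarrow> 'a set" where
  "absolute_interval W S c = {x \<in> carrier W. absolute_le W S x c}"

end

theory Submission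
  imports Defs "HOL-Library.Function_Algebras" "HOL-Library.Sublist" Complex_Main
begin

text \<open>
  Let \<open>V = \<real>\<^sup>S\<close> carry the bilinear form \<open>B\<close> of the Coxeter matrix, so that \<open>W\<close> acts on \<open>V\<close> and every
  reflection \<open>t\<close> acts as the orthogonal reflection in a root \<open>\<beta>\<^sub>t\<close>. A Coxeter element
  \<open>c\<close> prescribes the order in which two noncommuting reflections can occur in its short
  factorizations: if \<open>c = t\<^sub>1 \<dots> t\<^sub>n\<close> with at most \<open>|S|\<close> reflections, then \<open>c\<close> alone determines numbers
  \<open>E(\<beta>, \<beta>')\<close> with \<open>E(\<beta>\<^sub>i, \<beta>\<^sub>j) = 2 B(\<beta>\<^sub>i, \<beta>\<^sub>j)\<close> for \<open>i < j\<close> and \<open>E(\<beta>\<^sub>i, \<beta>\<^sub>j) = 0\<close> for \<open>i > j\<close>. If two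
  reflections occur in one order in one such factorization and in the opposite order in another,
  then \<open>B\<close> vanishes on their roots and they commute. Reduced expressions of \<open>x\<close> and \<open>y\<close> extend to such
  factorizations of \<open>c\<close>; having the same letters, they differ only by exchanging commuting letters.

  The form \<open>E\<close> is the nonsymmetric form of \<open>c\<close>, formally \<open>2 B (1 - c)\<^sup>-\<^sup>1\<close>. As \<open>B\<close> may be degenerate,
  \<open>1 - c\<close> need not be invertible on \<open>V\<close>, and \<open>V\<close> is replaced by \<open>V \<oplus> V\<^sup>*\<close> with the form
  \<open>B(v, w) + (f(w) + g(v)) / 2\<close> for \<open>(v, f)\<close> and \<open>(w, g)\<close>. Reflections in roots of \<open>V\<close> leave the component
  \<open>f\<close> alone, so this amounts to a family, indexed by \<open>f\<close>, of actions of \<open>W\<close> on \<open>V\<close> by affine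
  reflections \<open>v \<mapsto> v - (f(\<beta>) + 2 B(v, \<beta>)) \<beta>\<close>. Now every \<open>u \<in> V\<close> is the displacement \<open>0 - c 0\<close>
  for a suitable \<open>f\<close>, by solving a triangular system along the simple reflections of \<open>c\<close>
  (\<open>coxeter_element_surjective\<close>). For a factorization into \<open>t\<^sub>1 \<dots> t\<^sub>n\<close> the displacement lies in the span
  of the roots, so for \<open>n \<le> |S|\<close> the roots are linearly independent (\<open>roots_independent\<close>). Choosing \<open>f\<close>
  with displacement \<open>\<beta>\<^sub>j\<close> and comparing coefficients gives \<open>f(\<beta>\<^sub>i) = E(\<beta>\<^sub>i, \<beta>\<^sub>j)\<close> as above
  (\<open>factorization_pairing\<close>); the choice of \<open>f\<close> refers to \<open>c\<close> but not to the factorization.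

  That reflections with orthogonal roots commute in \<open>W\<close>, and not only in its image, is the
  faithfulness of the action for \<open>f = 0\<close> (\<open>rho_faithful\<close>), which follows from the positivity of roots
  (\<open>positive_root\<close>).
\<close>

section \<open>The reflection form and affine reflections\<close>

definition scale :: "real \<Rightarrow> ('a \<Rightarrow> real) \<Rightarrow> 'a \<Rightarrow> real" where
  "scale r v = (\<lambda>s. r * v s)"

lemma scale_apply: "scale r v s = r * v s"
  by (simp add: scale_def)

lemmas vec_apply = scale_apply plus_fun_apply zero_fun_apply minus_apply uminus_apply

text \<open>
  Under a binder, the pointwise rules would turn a vector \<open>v + w\<close> into an abstraction to which the linearity
  rules below no longer apply; they are therefore invoked only where equations are read off
  coordinatewise.
\<close>

declare plus_fun_apply [simp del] zero_fun_apply [simp del]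
  minus_apply [simp del] uminus_apply [simp del]

interpretation vec: vector_space scale
  by unfold_locales (auto simp: fun_eq_iff vec_apply algebra_simps)

locale coxeter_form =
  fixes S :: "'a set" and m :: "'a \<Rightarrow> 'a \<Rightarrow> nat"
  assumes finite_S: "finite S" and matrix: "coxeter_matrix S m"
begin

text \<open>
  An infinite entry of the Coxeter matrix is stored as 0; since division by 0 gives 0, the
  coefficient is then \<open>- cos 0 = -1\<close>, as it should be.
\<close>

definition form :: "('a \<Rightarrow> real) \<Rightarrow> ('a \<Rightarrow> real) \<Rightarrow> real" where
  "form v w = (\<Sum>s\<in>S. \<Sum>t\<in>S. v s * w t * (- cos (pi / real (m s t))))"

definition pair :: "('a \<Rightarrow> real) \<Rightarrow> ('a \<Rightarrow> real) \<Rightarrow> real" where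
  "pair f v = (\<Sum>s\<in>S. f s * v s)"

definition simple :: "'a \<Rightarrow> 'a \<Rightarrow> real" where
  "simple s = (\<lambda>t. if t = s then 1 else 0)"

text \<open>
  The reflection in \<open>b\<close> on the slice \<open>V \<times> {f}\<close> of \<open>V \<oplus> V\<^sup>*\<close>. For \<open>f = 0\<close> it is the orthogonal reflection
  when \<open>form b b = 1\<close>.
\<close>

definition reflect :: "('a \<Rightarrow> real) \<Rightarrow> ('a \<Rightarrow> real) \<Rightarrow> ('a \<Rightarrow> real) \<Rightarrow> 'a \<Rightarrow> real" where
  "reflect f b v = v - scale (pair f b + 2 * form v b) b"

lemma simple_apply: "simple s t = (if t = s then 1 else 0)"
  by (simp add: simple_def)

lemma m_sym: "s \<in> S \<Longrightarrow> t \<in> S \<Longrightarrow> m s t = m t s"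
  using matrix by (auto simp: coxeter_matrix_def)

lemma m_diag: "s \<in> S \<Longrightarrow> t \<in> S \<Longrightarrow> m s t = 1 \<longleftrightarrow> s = t"
  using matrix by (auto simp: coxeter_matrix_def)

lemma form_add_left [simp]: "form (u + v) w = form u w + form v w"
  by (simp add: form_def vec_apply algebra_simps sum.distrib sum_subtractf sum_negf)

lemma form_scale_left [simp]: "form (scale r v) w = r * form v w"
  by (simp add: form_def vec_apply sum_distrib_left mult_ac)

lemma form_sym: "form v w = form w v"
proof -
  have "form v w = (\<Sum>t\<in>S. \<Sum>s\<in>S. v s * w t * (- cos (pi / real (m s t))))"
    unfolding form_def by (rule sum.swap)
  also have "\<dots> = form w v"
    unfolding form_def by (intro sum.cong refl) (auto simp: m_sym)
  finally show ?thesis .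
qed

lemma form_scale_right [simp]: "form w (scale r v) = r * form w v"
  by (metis form_sym form_scale_left)

lemma form_uminus_left [simp]: "form (- v) w = - form v w"
  by (simp add: form_def vec_apply sum_negf)

lemma form_diff_left [simp]: "form (u - v) w = form u w - form v w"
  using form_add_left[of u "- v" w] by simp

lemma form_diff_right [simp]: "form w (u - v) = form w u - form w v"
  by (metis form_sym form_diff_left)

lemma form_zero_left [simp]: "form 0 w = 0"
  by (simp add: form_def vec_apply)

lemma pair_diff [simp]: "pair f (u - v) = pair f u - pair f v"
  by (simp add: pair_def vec_apply algebra_simps sum_subtractf)

lemma pair_scale [simp]: "pair f (scale r v) = r * pair f v"
  by (simp add: pair_def vec_apply sum_distrib_left mult_ac)

lemma pair_zero_left [simp]: "pair 0 v = 0"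
  by (simp add: pair_def vec_apply)

lemma form_simple: "s \<in> S \<Longrightarrow> t \<in> S \<Longrightarrow> form (simple s) (simple t) = - cos (pi / real (m s t))"
  by (simp add: form_def vec_apply simple_def if_distrib[where f="\<lambda>x. x * _"] if_distrib[where f="\<lambda>x. _ * x"]
      finite_S sum_negf cong: if_cong)

lemma form_simple_self: "s \<in> S \<Longrightarrow> form (simple s) (simple s) = 1"
  using m_diag[of s s] by (simp add: form_simple)

lemma pair_simple: "s \<in> S \<Longrightarrow> pair f (simple s) = f s"
  by (simp add: pair_def vec_apply simple_def if_distrib[where f="\<lambda>x. _ * x"] finite_S cong: if_cong)

lemma reflect_involution:
  assumes "form b b = 1"
  shows "reflect f b (reflect f b v) = v"
  by (rule ext) (simp add: reflect_def vec_apply assms algebra_simps)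

text \<open>
  The reflection in \<open>a\<close> preserves the form of \<open>V \<oplus> V\<^sup>*\<close>, and on its subspace \<open>V\<close> it acts without
  translation part, whence the \<open>0\<close>.
\<close>

lemma reflect_conjugate:
  assumes "form a a = 1"
  shows "reflect f a (reflect f b v) = reflect f (reflect 0 a b) (reflect f a v)"
proof -
  have "form b a = form a b" "form v a = form a v" "form v b = form b v"
    by (rule form_sym)+
  then show ?thesis
    by (intro ext) (simp add: reflect_def vec_apply assms algebra_simps)
qed

lemma form_reflect:
  assumes "form a a = 1"
  shows "form (reflect 0 a v) (reflect 0 a w) = form v w"
  using form_sym[of a v] form_sym[of w a] by (simp add: reflect_def vec_apply assms algebra_simps)

lemma reflect_add: "reflect f b (v + w) = reflect f b v + reflect 0 b w"
  by (rule ext) (simp add: reflect_def vec_apply algebra_simps)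

lemma reflect_scale: "reflect 0 b (scale r v) = scale r (reflect 0 b v)"
  by (rule ext) (simp add: reflect_def vec_apply algebra_simps)

end

section \<open>Alternating products of two simple reflections\<close>

text \<open>
  Chebyshev polynomials of the second kind with the index shifted by one. Unlike the quotients
  \<open>sin (k x) / sin x\<close>, they also cover the case \<open>x = 0\<close> of an infinite dihedral subgroup.
\<close>

fun chebyshev :: "real \<Rightarrow> nat \<Rightarrow> real" where
  "chebyshev c 0 = 0"
| "chebyshev c (Suc 0) = 1"
| "chebyshev c (Suc (Suc k)) = 2 * c * chebyshev c (Suc k) - chebyshev c k"

lemma sin_mult_chebyshev: "sin x * chebyshev (cos x) k = sin (real k * x)"
proof (induction "cos x" k rule: chebyshev.induct)
  case (3 k)
  have "sin (real k * x + 2 * x) = 2 * cos x * sin (real k * x + x) - sin (real k * x)"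
    unfolding sin_add cos_add sin_double cos_double_cos by algebra
  with 3 show ?case by (simp add: algebra_simps)
qed auto

lemma chebyshev_one: "chebyshev 1 k = real k"
  by (induction "1::real" k rule: chebyshev.induct) auto

lemma chebyshev_nonneg:
  assumes "n = 0 \<or> k \<le> n" "n \<noteq> 1"
  shows "0 \<le> chebyshev (cos (pi / real n)) k"
proof (cases "n = 0")
  case True then show ?thesis by (simp add: chebyshev_one)
next
  case False
  define x where "x = pi / real n"
  have x: "0 < x" "x < pi" using False assms(2) by (auto simp: x_def field_simps)
  have "real k * x \<le> pi" using False assms(1) by (auto simp: x_def field_simps)
  then have "0 \<le> sin (real k * x)" using x by (intro sin_ge_zero) auto
  with sin_gt_zero[OF x] show ?thesis
    unfolding x_def[symmetric] by (simp add: sin_mult_chebyshev[symmetric] zero_le_mult_iff)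
qed

context coxeter_form
begin

text \<open>
  The alternating word of the given length in two letters that ends in \<open>t\<close>.
\<close>

fun alt :: "'a \<Rightarrow> 'a \<Rightarrow> nat \<Rightarrow> 'a list" where
  "alt s t 0 = []"
| "alt s t (Suc k) = (if even k then t else s) # alt s t k"

lemma alt_append: "alt s t (Suc k) = alt t s k @ [t]"
  by (induction k) auto

lemma set_alt: "set (alt s t k) \<subseteq> {s, t}"
  by (induction k) auto

lemma length_alt [simp]: "length (alt s t k) = k"
  by (induction k) auto

lemma alt_split: "\<exists>p. length p = j \<and> set p \<subseteq> {s, t} \<and> alt s t (j + k) = p @ alt s t k"
proof (induction j)
  case (Suc j)
  then obtain p where "length p = j" "set p \<subseteq> {s, t}" "alt s t (j + k) = p @ alt s t k" by blast
  then show ?case by (intro exI[of _ "(if even (j + k) then t else s) # p"]) auto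
qed auto

definition act :: "('a \<Rightarrow> real) \<Rightarrow> 'a list \<Rightarrow> ('a \<Rightarrow> real) \<Rightarrow> 'a \<Rightarrow> real" where
  "act f ss v = foldr (\<lambda>s. reflect f (simple s)) ss v"

lemma act_Nil [simp]: "act f [] v = v"
  by (simp add: act_def)

lemma act_Cons [simp]: "act f (s # ss) v = reflect f (simple s) (act f ss v)"
  by (simp add: act_def)

lemma act_append: "act f (ss @ ts) v = act f ss (act f ts v)"
  by (simp add: act_def)

lemma act_add: "act f ss (v + w) = act f ss v + act 0 ss w"
  by (induction ss) (simp_all add: reflect_add)

lemma act_scale: "act 0 ss (scale r v) = scale r (act 0 ss v)"
  by (induction ss) (simp_all add: reflect_scale)

lemma act_rev_cancel: "set ss \<subseteq> S \<Longrightarrow> act f (rev ss) (act f ss v) = v"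
  by (induction ss arbitrary: v) (auto simp: act_append reflect_involution form_simple_self)

text \<open>
  Each further letter is a reflection inside the plane of the two simple roots, and turns the
  coefficients from one pair of consecutive Chebyshev values into the next by their recursion.
\<close>

lemma act_alt:
  assumes "s \<in> S" "t \<in> S"
  shows "act 0 (alt s t k) (simple s) =
    scale (chebyshev (cos (pi / real (m s t))) (Suc k)) (simple (if even k then s else t)) +
    scale (chebyshev (cos (pi / real (m s t))) k) (simple (if even k then t else s))"
proof (induction k)
  case 0 then show ?case by (auto simp: fun_eq_iff vec_apply)
next
  case (Suc k)
  have "form (simple t) (simple s) = - cos (pi / real (m s t))"
    using assms m_sym[of s t] by (simp add: form_simple)
  then show ?case unfolding alt.simps act_Cons Suc using assms
    by (intro ext) (auto simp: reflect_def vec_apply form_simple_self form_simple[OF assms] algebra_simps)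
qed

lemma act_alt_braid_simple:
  assumes "s \<in> S" "t \<in> S" "s \<noteq> t" "m s t \<noteq> 0"
  shows "act 0 (alt s t (2 * m s t)) (simple s) = simple s"
proof -
  define x where "x = pi / real (m s t)"
  have m: "m s t \<noteq> 1" using assms m_diag by blast
  have mx: "real (m s t) * x = pi" using assms by (simp add: x_def)
  have x: "0 < x" "x < pi" using assms m by (auto simp: x_def field_simps)
  then have pos: "sin x > 0" by (rule sin_gt_zero)
  have "sin x * chebyshev (cos x) (2 * m s t) = sin (2 * (real (m s t) * x))"
    by (simp add: sin_mult_chebyshev mult_ac)
  then have "chebyshev (cos x) (2 * m s t) = 0" using pos mx by simp
  moreover
  have "sin x * chebyshev (cos x) (Suc (2 * m s t)) = sin (2 * (real (m s t) * x) + x)"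
    by (simp add: sin_mult_chebyshev algebra_simps)
  then have "chebyshev (cos x) (Suc (2 * m s t)) = 1" using pos mx
    by (simp add: sin_add)
  ultimately show ?thesis using act_alt[OF assms(1,2), of "2 * m s t"]
    by (simp add: x_def fun_eq_iff vec_apply del: chebyshev.simps)
qed

lemma rev_alt_even: "rev (alt s t (2 * k)) = alt t s (2 * k)"
proof (induction k)
  case (Suc k)
  have "alt t s (Suc (Suc (2 * k))) = alt t s (2 * k) @ [t, s]"
    by (simp only: alt_append) simp
  with Suc show ?case by simp
qed auto

text \<open>
  The Coxeter relations hold in every affine deformation: for finite \<open>m s t\<close> with \<open>s \<noteq> t\<close> the form is
  nondegenerate on the plane of the two simple roots, so a translation of \<open>v\<close> inside that plane is
  fixed by both reflections. Relative to this fixed point only the linear action matters, and that is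
  a rotation of finite order.
\<close>

lemma act_alt_braid:
  assumes s: "s \<in> S" and t: "t \<in> S" and fin: "m s t \<noteq> 0"
  shows "act f (alt s t (2 * m s t)) v = v"
proof (cases "s = t")
  case True
  then have "m s t = 1" using m_diag s t by blast
  with True s show ?thesis by (simp add: reflect_involution form_simple_self numeral_2_eq_2)
next
  case False
  let ?w = "alt s t (2 * m s t)" and ?c = "cos (pi / real (m s t))"
  have m: "m s t \<noteq> 1" using m_diag s t False by blast
  have fixes_s: "act 0 ?w (simple s) = simple s"
    by (rule act_alt_braid_simple[OF s t False fin])
  have "act 0 (alt t s (2 * m s t)) (simple t) = simple t"
    using act_alt_braid_simple[OF t s] False fin m_sym[OF s t] by simp
  then have fixes_t: "act 0 ?w (simple t) = simple t"
    using act_rev_cancel[of "alt t s (2 * m s t)" 0 "simple t"] set_alt[of t s] s t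
    by (auto simp: rev_alt_even)
  have "0 < sin (pi / real (m s t))"
    using fin m by (intro sin_gt_zero) (auto simp: field_simps)
  then have det: "1 - ?c\<^sup>2 \<noteq> 0"
    by (simp add: sin_squared_eq[symmetric])
  define p q where "p = pair f (simple s) + 2 * form v (simple s)"
    and "q = pair f (simple t) + 2 * form v (simple t)"
  \<comment> \<open>The coefficients solve the two equations which make \<open>v + u\<close> a common fixed point.\<close>
  define a b where "a = - (p + ?c * q) / (2 * (1 - ?c\<^sup>2))" and "b = - (q + ?c * p) / (2 * (1 - ?c\<^sup>2))"
  define u where "u = scale a (simple s) + scale b (simple t)"
  have ab: "p + 2 * a - 2 * ?c * b = 0" "q + 2 * b - 2 * ?c * a = 0"
    unfolding a_def b_def using det by (simp_all add: field_simps power2_eq_square)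
  have "form (simple t) (simple s) = - ?c"
    using s t m_sym[of s t] by (simp add: form_simple)
  then have "pair f (simple r) + 2 * form (v + u) (simple r) = 0" if "r \<in> {s, t}" for r
    using that ab s t
    by (auto simp: u_def p_def q_def form_simple_self form_simple[OF s t] algebra_simps)
  then have refl: "reflect f (simple r) (v + u) = v + u" if "r \<in> {s, t}" for r
    using that by (simp add: reflect_def)
  have "set w \<subseteq> {s, t} \<Longrightarrow> act f w (v + u) = v + u" for w
    by (induction w) (auto simp: refl)
  then have "act f ?w (v + u) = v + u" using set_alt by blast
  moreover have "act f ?w (v + u) = act f ?w v + act 0 ?w u" by (rule act_add)
  moreover have "act 0 ?w u = u" unfolding u_def by (simp add: act_add act_scale fixes_s fixes_t)
  ultimately show ?thesis by simp
qed

end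

section \<open>The affine actions of a Coxeter group\<close>

context group
begin

lemma list_prod_Nil [simp]: "list_prod G [] = \<one>"
  by (simp add: list_prod_def)

lemma list_prod_Cons [simp]: "list_prod G (x # xs) = x \<otimes> list_prod G xs"
  by (simp add: list_prod_def)

lemma list_prod_closed [simp, intro]: "set xs \<subseteq> carrier G \<Longrightarrow> list_prod G xs \<in> carrier G"
  by (induction xs) auto

lemma list_prod_append:
  "set xs \<subseteq> carrier G \<Longrightarrow> set ys \<subseteq> carrier G \<Longrightarrow>
    list_prod G (xs @ ys) = list_prod G xs \<otimes> list_prod G ys"
  by (induction xs) (auto simp: m_assoc)

end

locale coxeter_group = coxeter_form S m + group W
  for W :: "('a, 'b) monoid_scheme" (structure) and S :: "'a set" and m :: "'a \<Rightarrow> 'a \<Rightarrow> nat" +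
  assumes presented: "presented_by W S (coxeter_relators S m)"
begin

lemma S_carrier: "S \<subseteq> carrier W"
  using presented by (simp add: presented_by_def)

lemma eval_word_eq_iff:
  "u \<in> group_words S \<Longrightarrow> v \<in> group_words S \<Longrightarrow>
    eval_word W u = eval_word W v \<longleftrightarrow> presentation_eq S (coxeter_relators S m) u v"
  using presented by (simp add: presented_by_def)

lemma eval_word_positive: "eval_word W (map (\<lambda>s. (s, True)) ss) = list_prod W ss"
  by (simp add: eval_word_def comp_def)

lemma positive_word: "set ss \<subseteq> S \<Longrightarrow> map (\<lambda>s. (s, True)) ss \<in> group_words S"
  by (auto simp: group_words_def lists_eq_set)

lemma relator_map: "concat (replicate k [(s, True), (t, True)]) = map (\<lambda>s. (s, True)) (alt s t (2 * k))"
  by (induction k) auto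

lemma set_alt_S: "s \<in> S \<Longrightarrow> t \<in> S \<Longrightarrow> set (alt s t k) \<subseteq> S"
  using set_alt[of s t k] by auto

lemma list_prod_relator:
  assumes "s \<in> S" "t \<in> S"
  shows "list_prod W (alt s t (2 * m s t)) = \<one>"
proof (cases "m s t = 0")
  case False
  let ?r = "map (\<lambda>s. (s, True)) (alt s t (2 * m s t))"
  have "?r \<in> coxeter_relators S m"
    using False assms relator_map[of "m s t" s t] unfolding coxeter_relators_def by force
  then have "presentation_eq S (coxeter_relators S m) ([] @ ?r @ []) ([] @ [])"
    by (intro presentation_eq.relator) (auto simp: group_words_def)
  moreover have "?r \<in> group_words S" "[] \<in> group_words S"
    by (intro positive_word set_alt_S assms) (simp add: group_words_def)
  ultimately have "eval_word W ?r = eval_word W []"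
    by (simp add: eval_word_eq_iff)
  then show ?thesis by (simp add: eval_word_positive) (simp add: eval_word_def)
qed simp

lemma generator_square:
  assumes "s \<in> S"
  shows "s \<otimes> s = \<one>"
proof -
  have "m s s = 1" using assms m_diag by blast
  then show ?thesis using list_prod_relator[OF assms assms] assms S_carrier
    by (auto simp: numeral_2_eq_2)
qed

lemma generator_inv: "s \<in> S \<Longrightarrow> inv s = s"
  using generator_square S_carrier by (metis inv_equality subsetD)

lemma list_prod_rev:
  "set ss \<subseteq> S \<Longrightarrow> list_prod W (rev ss) = inv (list_prod W ss)"
proof (induction ss)
  case (Cons s ss)
  then have c: "s \<in> carrier W" "set ss \<subseteq> carrier W" using S_carrier by auto
  then have "list_prod W (rev (s # ss)) = list_prod W (rev ss) \<otimes> s"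
    by (simp add: list_prod_append)
  with Cons c show ?case by (simp add: inv_mult_group generator_inv)
qed simp

lemma generated:
  assumes "g \<in> carrier W"
  shows "\<exists>ss. set ss \<subseteq> S \<and> list_prod W ss = g"
proof -
  have "g \<in> eval_word W ` group_words S"
    using presented assms by (simp add: presented_by_def)
  then obtain u where u: "u \<in> group_words S" "eval_word W u = g" by blast
  from u(1) have "eval_word W u = list_prod W (map fst u)"
    unfolding group_words_def eval_word_def
    by (induction u rule: lists.induct) (auto simp: generator_inv)
  with u show ?thesis by (intro exI[of _ "map fst u"]) (auto simp: group_words_def)
qed

lemma act_presentation_eq:
  assumes "presentation_eq S (coxeter_relators S m) u v"
  shows "act f (map fst u) = act f (map fst v)"
  using assms
proof induction
  case (cancel u v s b)
  then show ?case
    by (intro ext) (simp add: act_append reflect_involution form_simple_self)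
next
  case (relator u v r)
  then obtain s t where st: "s \<in> S" "t \<in> S" "m s t \<noteq> 0"
    and r: "r = concat (replicate (m s t) [(s, True), (t, True)])"
    unfolding coxeter_relators_def by blast
  have "map fst r = alt s t (2 * m s t)"
    unfolding r relator_map by (simp add: comp_def)
  then show ?case using st by (intro ext) (simp add: act_append act_alt_braid)
qed auto

lemma act_well_defined:
  assumes "set ss \<subseteq> S" "set ts \<subseteq> S" "list_prod W ss = list_prod W ts"
  shows "act f ss = act f ts"
proof -
  have "presentation_eq S (coxeter_relators S m) (map (\<lambda>s. (s, True)) ss) (map (\<lambda>s. (s, True)) ts)"
    using assms by (simp add: eval_word_eq_iff[symmetric] positive_word eval_word_positive)
  from act_presentation_eq[OF this] show ?thesis by (simp add: comp_def)
qed

text \<open>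
  By \<open>act_well_defined\<close>, the choice of the word is immaterial.
\<close>

definition rho :: "('a \<Rightarrow> real) \<Rightarrow> 'a \<Rightarrow> ('a \<Rightarrow> real) \<Rightarrow> 'a \<Rightarrow> real" where
  "rho f g = act f (SOME ss. set ss \<subseteq> S \<and> list_prod W ss = g)"

lemma rho_list_prod:
  assumes "set ss \<subseteq> S"
  shows "rho f (list_prod W ss) = act f ss"
proof -
  let ?P = "\<lambda>us. set us \<subseteq> S \<and> list_prod W us = list_prod W ss"
  have "?P (SOME us. ?P us)" using assms by (intro someI[of ?P ss]) simp
  then show ?thesis unfolding rho_def using assms by (intro act_well_defined) auto
qed

lemma rho_mult:
  assumes "g \<in> carrier W" "h \<in> carrier W"
  shows "rho f (g \<otimes> h) v = rho f g (rho f h v)"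
proof -
  obtain ss ts where "set ss \<subseteq> S" "list_prod W ss = g" "set ts \<subseteq> S" "list_prod W ts = h"
    using generated assms by metis
  then show ?thesis
    using rho_list_prod[of "ss @ ts" f] rho_list_prod[of ss f] rho_list_prod[of ts f] S_carrier
    by (auto simp: list_prod_append act_append)
qed

lemma rho_one [simp]: "rho f \<one> v = v"
  using rho_list_prod[of "[]" f] by simp

lemma rho_generator: "s \<in> S \<Longrightarrow> rho f s v = reflect f (simple s) v"
  using rho_list_prod[of "[s]" f] S_carrier by auto

lemma rho_add: "g \<in> carrier W \<Longrightarrow> rho f g (v + w) = rho f g v + rho 0 g w"
  using generated[of g] by (auto simp: rho_list_prod act_add)

lemma rho_scale: "g \<in> carrier W \<Longrightarrow> rho 0 g (scale r v) = scale r (rho 0 g v)"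
  using generated[of g] by (auto simp: rho_list_prod act_scale)

section \<open>Positivity of roots and faithfulness\<close>

definition len :: "'a \<Rightarrow> nat" where
  "len g = (LEAST n. \<exists>ss. set ss \<subseteq> S \<and> length ss = n \<and> list_prod W ss = g)"

lemma len_le: "set ss \<subseteq> S \<Longrightarrow> len (list_prod W ss) \<le> length ss"
  unfolding len_def by (rule Least_le) auto

lemma reduced_word:
  assumes "g \<in> carrier W"
  shows "\<exists>ss. set ss \<subseteq> S \<and> length ss = len g \<and> list_prod W ss = g"
proof -
  obtain ss where "set ss \<subseteq> S" "list_prod W ss = g" using generated assms by blast
  then show ?thesis unfolding len_def
    by (intro LeastI[of "\<lambda>n. \<exists>ss. set ss \<subseteq> S \<and> length ss = n \<and> list_prod W ss = g" "length ss"]) auto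
qed

lemma len_mult_le:
  assumes "g \<in> carrier W" "h \<in> carrier W"
  shows "len (g \<otimes> h) \<le> len g + len h"
proof -
  obtain ss ts where "set ss \<subseteq> S" "length ss = len g" "list_prod W ss = g"
    "set ts \<subseteq> S" "length ts = len h" "list_prod W ts = h"
    using reduced_word assms by metis
  then show ?thesis using len_le[of "ss @ ts"] S_carrier by (auto simp: list_prod_append)
qed

lemma right_descent:
  assumes "g \<in> carrier W" "g \<noteq> \<one>"
  shows "\<exists>t\<in>S. len (g \<otimes> t) < len g"
proof -
  obtain ss where ss: "set ss \<subseteq> S" "length ss = len g" "list_prod W ss = g"
    using reduced_word assms by metis
  with assms(2) have "ss \<noteq> []" by auto
  then obtain us t where us: "ss = us @ [t]" by (metis rev_exhaust)
  with ss have t: "t \<in> S" "set us \<subseteq> S" "t \<in> carrier W" "set us \<subseteq> carrier W" using S_carrier by auto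
  have "g \<otimes> t = list_prod W us"
    using ss us t by (auto simp: list_prod_append m_assoc generator_square)
  then show ?thesis using len_le[of us] t ss us by (intro bexI[of _ t]) auto
qed

abbreviation altp :: "'a \<Rightarrow> 'a \<Rightarrow> nat \<Rightarrow> 'a" where
  "altp s t k \<equiv> list_prod W (alt s t k)"

lemma altp_closed [simp]: "s \<in> S \<Longrightarrow> t \<in> S \<Longrightarrow> altp s t k \<in> carrier W"
  using set_alt_S S_carrier by blast

text \<open>
  An alternating word with more than \<open>m s t\<close> letters can be shortened: the last \<open>m s t + 1\<close> letters are
  the complement of \<open>m s t - 1\<close> letters in the trivial alternating word of length \<open>2 m s t\<close>.
\<close>

lemma len_altp_less:
  assumes s: "s \<in> S" and t: "t \<in> S" and m: "m s t \<noteq> 0" "m s t \<le> k"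
  shows "len (altp s t k \<otimes> s) < k"
proof -
  let ?n = "m s t"
  have c: "s \<in> carrier W" "t \<in> carrier W" using s t S_carrier by auto
  have mts: "m t s = ?n" using m_sym s t by simp
  have "altp s t k \<otimes> s = altp t s (Suc k)"
    using set_alt_S[OF s t, of k] S_carrier c by (simp only: alt_append, subst list_prod_append) auto
  obtain p where p: "length p = k - ?n" "set p \<subseteq> {t, s}" "alt t s (k - ?n + Suc ?n) = p @ alt t s (Suc ?n)"
    using alt_split by blast
  obtain q where q: "length q = ?n - 1" "set q \<subseteq> {t, s}" "alt t s (?n - 1 + Suc ?n) = q @ alt t s (Suc ?n)"
    using alt_split by blast
  have pq: "set p \<subseteq> S" "set q \<subseteq> S" "set p \<subseteq> carrier W" "set q \<subseteq> carrier W"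
    using p(2) q(2) s t c by auto
  have alt: "set (alt t s (Suc ?n)) \<subseteq> carrier W" using set_alt_S[OF t s] S_carrier by blast
  have "?n - 1 + Suc ?n = 2 * m t s" using m mts by simp
  then have "list_prod W q \<otimes> altp t s (Suc ?n) = \<one>"
    using list_prod_relator[OF t s] q(3) list_prod_append[OF pq(4) alt] by simp
  then have "altp t s (Suc ?n) = inv (list_prod W q)"
    using pq alt by (metis inv_equality inv_inv list_prod_closed)
  then have "altp t s (Suc ?n) = list_prod W (rev q)"
    using list_prod_rev pq by simp
  moreover have "altp t s (Suc k) = list_prod W p \<otimes> altp t s (Suc ?n)"
    using p(3) m list_prod_append[OF pq(3) alt] by simp
  ultimately have "altp s t k \<otimes> s = list_prod W (p @ rev q)"
    using pq \<open>altp s t k \<otimes> s = altp t s (Suc k)\<close> by (simp add: list_prod_append)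
  then show ?thesis using len_le[of "p @ rev q"] pq p q m by simp
qed

text \<open>
  Choose a right descent \<open>t\<close> of \<open>w\<close> and split off the longest alternating suffix in \<open>s\<close> and \<open>t\<close> that
  ends in \<open>t\<close> and whose length is exactly the loss in length of \<open>w\<close>. The suffix sends the simple root of \<open>s\<close> to a nonnegative
  combination of the simple roots of \<open>s\<close> and \<open>t\<close>, since its length is below \<open>m s t\<close> if
  this is finite. The remaining prefix
  is shorter than \<open>w\<close> and, the suffix being maximal, has neither \<open>s\<close> nor \<open>t\<close> as a descent, so that the
  induction hypothesis applies to both simple roots.
\<close>

lemma positive_root:
  assumes "w \<in> carrier W" "s \<in> S" "len w \<le> len (w \<otimes> s)"
  shows "0 \<le> rho 0 w (simple s) x"
  using assms
proof (induction "len w" arbitrary: w s rule: less_induct)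
  case less
  note w = \<open>w \<in> carrier W\<close> and s = \<open>s \<in> S\<close>
  have sc: "s \<in> carrier W" using s S_carrier by auto
  show ?case
  proof (cases "w = \<one>")
    case True
    then show ?thesis by (simp add: simple_apply)
  next
    case False
    then obtain t where t: "t \<in> S" "len (w \<otimes> t) < len w" using right_descent w by blast
    have tc: "t \<in> carrier W" using t S_carrier by auto
    have st: "s \<noteq> t" using t less.prems(3) by auto
    define P where "P k \<longleftrightarrow> (\<exists>v\<in>carrier W. w = v \<otimes> altp s t k \<and> len w = len v + k)" for k
    have bound: "P k \<Longrightarrow> k \<le> len w" for k by (auto simp: P_def)
    have "w = (w \<otimes> t) \<otimes> altp s t (Suc 0)"
      using w tc t by (simp add: m_assoc generator_square)
    moreover from this have "len w \<le> len (w \<otimes> t) + 1"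
      using len_mult_le[of "w \<otimes> t" t] len_le[of "[t]"] w tc t by simp
    ultimately have P1: "P 1" unfolding P_def using w tc t
      by (intro bexI[of _ "w \<otimes> t"]) auto
    define k where "k = (GREATEST k. P k)"
    have Pk: "P k" unfolding k_def by (rule GreatestI_nat[of P 1 "len w"]) (use P1 bound in auto)
    have k_max: "P j \<Longrightarrow> j \<le> k" for j
      unfolding k_def by (rule Greatest_le_nat[of P j "len w"]) (use bound in auto)
    have k1: "1 \<le> k" using k_max[OF P1] .
    obtain v where v: "v \<in> carrier W" "w = v \<otimes> altp s t k" "len w = len v + k"
      using Pk by (auto simp: P_def)
    have altk: "altp s t k \<in> carrier W" using s t by simp
    have no_descent: "len v \<le> len (v \<otimes> r)" if r: "r \<in> {s, t}" for r
    proof (rule ccontr)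
      assume less_r: "\<not> len v \<le> len (v \<otimes> r)"
      have rS: "r \<in> S" and rc: "r \<in> carrier W" using r s t sc tc by auto
      have v_eq: "v = (v \<otimes> r) \<otimes> r" using v rc rS by (simp add: m_assoc generator_square)
      show False
      proof (cases "r = (if even k then t else s)")
        \<comment> \<open>The letter \<open>r\<close> would prolong the alternating suffix, against maximality.\<close>
        case True
        then have "altp s t (Suc k) = r \<otimes> altp s t k" by simp
        then have w_eq: "w = (v \<otimes> r) \<otimes> altp s t (Suc k)"
          using v v_eq rc altk by (metis m_assoc m_closed)
        have "len w \<le> len (v \<otimes> r) + Suc k"
          using len_mult_le[of "v \<otimes> r" "altp s t (Suc k)"] len_le[OF set_alt_S[OF s t(1), of "Suc k"]]
            v rc s t w_eq by (simp del: alt.simps)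
        then have "P (Suc k)" using less_r v rc w_eq unfolding P_def
          by (intro bexI[of _ "v \<otimes> r"]) auto
        then show False using k_max by fastforce
      next
        \<comment> \<open>The letter \<open>r\<close> would cancel the first letter of the suffix and make \<open>w\<close> too short.\<close>
        case False
        obtain j where j: "k = Suc j" using k1 by (cases k) auto
        have "altp s t k = r \<otimes> altp s t j" using False r j by auto
        then have "w = (v \<otimes> r) \<otimes> altp s t j"
          using v rc rS s t by (simp add: m_assoc[symmetric])
        then have "len w \<le> len (v \<otimes> r) + j"
          using len_mult_le[of "v \<otimes> r" "altp s t j"] len_le[OF set_alt_S[OF s t(1), of j]]
            v rc s t by simp
        then show False using less_r v j by simp
      qed
    qed
    have "m s t = 0 \<or> Suc k \<le> m s t"
    proof (rule ccontr)
      assume "\<not> (m s t = 0 \<or> Suc k \<le> m s t)"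
      then have "len (altp s t k \<otimes> s) < k" using s t by (intro len_altp_less) auto
      moreover have "w \<otimes> s = v \<otimes> (altp s t k \<otimes> s)" using v altk sc by (simp add: m_assoc)
      ultimately have "len (w \<otimes> s) < len v + k"
        using len_mult_le[of v "altp s t k \<otimes> s"] v altk sc by simp
      then show False using less.prems(3) v by simp
    qed
    moreover have "m s t \<noteq> 1" using m_diag s t st by blast
    ultimately have nonneg: "0 \<le> chebyshev (cos (pi / real (m s t))) (Suc k)"
      "0 \<le> chebyshev (cos (pi / real (m s t))) k"
      by (auto intro!: chebyshev_nonneg)
    have IH: "0 \<le> rho 0 v (simple r) x" if "r \<in> {s, t}" for r
      using less.hyps[of v r] no_descent[OF that] v k1 that s t by auto
    have "rho 0 w (simple s) = rho 0 v (act 0 (alt s t k) (simple s))"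
      using v altk rho_list_prod[OF set_alt_S[OF s t(1)]] by (simp add: rho_mult)
    then show ?thesis using nonneg IH v
      by (simp add: act_alt s t rho_add rho_scale vec_apply del: chebyshev.simps)
  qed
qed

text \<open>
  If \<open>s\<close> is a right descent of \<open>w\<close>, then \<open>w s\<close> makes the simple root of \<open>s\<close> positive, whereas it would
  make it negative if \<open>w\<close> acted trivially.
\<close>

lemma rho_faithful:
  assumes w: "w \<in> carrier W" and triv: "\<And>v. rho 0 w v = v"
  shows "w = \<one>"
proof (rule ccontr)
  assume "w \<noteq> \<one>"
  then obtain s where s: "s \<in> S" "len (w \<otimes> s) < len w" using right_descent w by blast
  have sc: "s \<in> carrier W" using s S_carrier by auto
  have "0 \<le> rho 0 (w \<otimes> s) (simple s) s"
    using positive_root[of "w \<otimes> s" s s] s w sc by (simp add: m_assoc generator_square)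
  also have "rho 0 (w \<otimes> s) (simple s) = reflect 0 (simple s) (simple s)"
    using w sc s triv by (simp add: rho_mult rho_generator)
  finally show False using s by (simp add: reflect_def form_simple_self vec_apply simple_apply)
qed

lemma rho_injective:
  assumes "g \<in> carrier W" "h \<in> carrier W" "\<And>v. rho 0 g v = rho 0 h v"
  shows "g = h"
proof -
  have "rho 0 (inv h \<otimes> g) v = v" for v
    using assms rho_mult[of "inv h" h 0 v] by (simp add: rho_mult)
  then have "inv h \<otimes> g = \<one>" using assms by (intro rho_faithful) auto
  then show ?thesis using assms by (metis inv_equality inv_inv inv_closed)
qed

end

section \<open>Rearrangements and products of affine reflections\<close>

lemma sum_apply_vec: "(\<Sum>i\<in>I. g i) x = (\<Sum>i\<in>I. g i x :: real)"
  by (induction I rule: infinite_finite_induct) (simp_all add: vec_apply)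

text \<open>
  The first letter of \<open>xs\<close> commutes with all letters that precede it in \<open>ys\<close>, hence can be moved to the
  front of \<open>ys\<close>.
\<close>

lemma (in group) list_prod_rearrangement:
  assumes "distinct xs" "distinct ys" "set xs = set ys" "set xs \<subseteq> carrier G"
    and "\<And>a b. subseq [a, b] xs \<Longrightarrow> subseq [b, a] ys \<Longrightarrow> a \<otimes> b = b \<otimes> a"
  shows "list_prod G xs = list_prod G ys"
  using assms
proof (induction xs arbitrary: ys)
  case (Cons x xs)
  then obtain us vs where ys: "ys = us @ x # vs" by (metis list.set_intros(1) split_list)
  have xc: "x \<in> carrier G" and uv: "set us \<subseteq> carrier G" "set vs \<subseteq> carrier G"
    using Cons.prems(3,4) ys by auto
  have "x \<otimes> u = u \<otimes> x" if "u \<in> set us" for u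
  proof (rule Cons.prems(5))
    have "u \<in> set xs" using that Cons.prems(2,3) ys by auto
    then show "subseq [x, u] (x # xs)" by (simp add: subseq_singleton_left)
    have "subseq ([u] @ [x]) (us @ x # vs)"
      using that by (intro list_emb_append_mono) (auto simp: subseq_singleton_left)
    then show "subseq [u, x] ys" using ys by simp
  qed
  then have comm: "list_prod G us \<otimes> x = x \<otimes> list_prod G us"
    using uv(1)
  proof (induction us)
    case (Cons u us)
    then have "u \<in> carrier G" "set us \<subseteq> carrier G" "x \<otimes> u = u \<otimes> x" by auto
    with Cons xc show ?case by simp (metis m_assoc list_prod_closed)
  qed (use xc in auto)
  have "list_prod G xs = list_prod G (us @ vs)"
  proof (rule Cons.IH)
    show "set xs = set (us @ vs)" using Cons.prems(1-3) ys by auto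
    show "distinct xs" "distinct (us @ vs)" "set xs \<subseteq> carrier G"
      using Cons.prems(1,2,4) ys by auto
    fix a b assume ab: "subseq [a, b] xs" "subseq [b, a] (us @ vs)"
    have "subseq (us @ vs) ys" unfolding ys by (intro list_emb_append_mono) auto
    with ab(2) have "subseq [b, a] ys" by (rule subseq_order.trans)
    with ab(1) show "a \<otimes> b = b \<otimes> a" by (intro Cons.prems(5) list_emb_Cons)
  qed
  with comm xc uv show ?case unfolding ys
    by (simp add: list_prod_append m_assoc[symmetric])
qed auto

context coxeter_form
begin

lemma foldr_reflect_span: "foldr (reflect f) bs v - v \<in> vec.span (set bs)"
proof (induction bs)
  case (Cons b bs)
  let ?w = "foldr (reflect f) bs v"
  have "?w - v \<in> vec.span (set (b # bs))"
    using Cons vec.span_mono[of "set bs" "set (b # bs)"] by auto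
  moreover have "scale k b \<in> vec.span (set (b # bs))" for k
    by (intro vec.span_scale vec.span_base) simp
  ultimately have "?w - v - scale (pair f b + 2 * form ?w b) b \<in> vec.span (set (b # bs))"
    by (rule vec.span_diff)
  then show ?case by (simp add: reflect_def[of f b] diff_right_commute)
qed (simp add: vec.span_zero)

text \<open>
  The displacement of \<open>v\<close> in coordinates. The coefficient of \<open>b\<close> depends on the coefficients of the
  vectors to the right of \<open>b\<close> only, because the product is applied from the right; this triangular
  shape is what lets a factorization record the order of its letters.
\<close>

lemma foldr_reflect_coordinates:
  assumes "distinct bs"
  shows "\<exists>x. foldr (reflect f) bs v = v - (\<Sum>b\<in>set bs. scale (x b) b) \<and>
    (\<forall>p b q. bs = p @ b # q \<longrightarrow>
      x b = pair f b + 2 * form (v - (\<Sum>d\<in>set q. scale (x d) d)) b)"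
  using assms
proof (induction bs)
  case (Cons a bs)
  then have "distinct bs" by simp
  from Cons.IH[OF this] obtain x where x: "foldr (reflect f) bs v = v - (\<Sum>b\<in>set bs. scale (x b) b)"
    "\<And>p b q. bs = p @ b # q \<Longrightarrow> x b = pair f b + 2 * form (v - (\<Sum>d\<in>set q. scale (x d) d)) b"
    by (elim exE conjE) simp
  let ?w = "v - (\<Sum>b\<in>set bs. scale (x b) b)"
  define y where "y = x(a := pair f a + 2 * form ?w a)"
  have y_eq: "(\<Sum>b\<in>B. scale (y b) b) = (\<Sum>b\<in>B. scale (x b) b)" if "B \<subseteq> set bs" for B
    using that Cons.prems by (intro sum.cong) (auto simp: y_def)
  show ?case
  proof (intro exI[of _ y] conjI allI impI)
    have "foldr (reflect f) (a # bs) v = ?w - scale (y a) a"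
      by (simp add: x(1) reflect_def[of f a] y_def)
    also have "\<dots> = v - (\<Sum>b\<in>set (a # bs). scale (y b) b)"
      using Cons.prems y_eq[of "set bs"] by (simp add: algebra_simps)
    finally show "foldr (reflect f) (a # bs) v = v - (\<Sum>b\<in>set (a # bs). scale (y b) b)" .
    fix p b q assume split: "a # bs = p @ b # q"
    then show "y b = pair f b + 2 * form (v - (\<Sum>d\<in>set q. scale (y d) d)) b"
    proof (cases p)
      case Nil
      then have "b = a" "q = bs" using split by auto
      then show ?thesis using y_eq[of "set bs"] by (simp add: y_def)
    next
      case p: (Cons a' p')
      then have bs: "bs = p' @ b # q" using split by auto
      then have "b \<noteq> a" using Cons.prems by auto
      moreover have "(\<Sum>d\<in>set q. scale (y d) d) = (\<Sum>d\<in>set q. scale (x d) d)"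
        by (rule y_eq) (auto simp: bs)
      ultimately show ?thesis using x(2)[OF bs] by (simp add: y_def)
    qed
  qed
qed auto

lemma independent_simple: "vec.independent (simple ` S)"
proof -
  have inj: "inj_on simple S" by (auto simp: inj_on_def simple_apply fun_eq_iff split: if_splits)
  have "u (simple s) = 0" if s: "s \<in> S" and eq: "(\<Sum>b\<in>simple ` S. scale (u b) b) = 0" for u s
  proof -
    have "0 = (\<Sum>r\<in>S. scale (u (simple r)) (simple r)) s"
      using eq inj by (simp add: sum.reindex vec_apply)
    also have "\<dots> = (\<Sum>r\<in>S. if r = s then u (simple r) else 0)"
      unfolding sum_apply_vec by (intro sum.cong) (auto simp: vec_apply simple_apply)
    finally show ?thesis using s finite_S by simp
  qed
  then show ?thesis using finite_S by (auto simp: vec.dependent_finite)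
qed

lemma card_simple: "card (simple ` S) = card S"
  by (rule card_image) (auto simp: inj_on_def simple_apply fun_eq_iff split: if_splits)

lemma act_cong: "set ss \<subseteq> S \<Longrightarrow> (\<And>s. s \<in> set ss \<Longrightarrow> f s = g s) \<Longrightarrow> act f ss v = act g ss v"
  by (induction ss) (auto simp: reflect_def pair_simple)

text \<open>
  The values of \<open>f\<close> are found one letter at a time from the right: the leftmost reflection is the only
  one that involves \<open>f s\<close>, and its displacement can be adjusted to any multiple of the simple root.
\<close>

lemma act_surjective:
  assumes "distinct ss" "set ss \<subseteq> S" "\<And>s. s \<notin> set ss \<Longrightarrow> u s = 0"
  shows "\<exists>f. act f ss 0 = - u"
  using assms
proof (induction ss arbitrary: u)
  case Nil
  then have "u = 0" by (auto simp: vec_apply fun_eq_iff)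
  then show ?case by simp
next
  case (Cons s ss)
  define u' where "u' = u(s := 0)"
  have "u' r = 0" if "r \<notin> set ss" for r
    using that Cons.prems(3)[of r] by (auto simp: u'_def)
  then obtain f where f: "act f ss 0 = - u'"
    using Cons.IH[of u'] Cons.prems(1,2) by fastforce
  define g where "g = f(s := u s + 2 * form u' (simple s))"
  have "act g ss 0 = act f ss 0"
    by (rule act_cong) (use Cons.prems in \<open>auto simp: g_def\<close>)
  then have "act g ss 0 = - u'" using f by simp
  moreover have "u = u' + scale (u s) (simple s)"
    by (auto simp: u'_def simple_apply vec_apply fun_eq_iff)
  moreover have "act g (s # ss) 0 = - (u' + scale (u s) (simple s))"
    using Cons.prems calculation(1) by (simp add: reflect_def pair_simple g_def)
  ultimately have "act g (s # ss) 0 = - u" by simp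
  then show ?case by blast
qed

end

section \<open>Roots of reflections\<close>

context coxeter_group
begin

text \<open>
  One vector must serve all deformations \<open>f\<close> at once: in \<open>V \<oplus> V\<^sup>*\<close> the root of a reflection lies in \<open>V\<close>.
\<close>

definition is_root :: "'a \<Rightarrow> ('a \<Rightarrow> real) \<Rightarrow> bool" where
  "is_root t b \<longleftrightarrow> form b b = 1 \<and> (\<forall>s. s \<notin> S \<longrightarrow> b s = 0) \<and> (\<forall>f v. rho f t v = reflect f b v)"

lemma conjugate_root:
  assumes "set ss \<subseteq> S" "s \<in> S"
  shows "\<exists>b. is_root (list_prod W ss \<otimes> s \<otimes> inv (list_prod W ss)) b"
  using assms(1)
proof (induction ss)
  case Nil
  have "is_root s (simple s)"
    using assms(2) by (auto simp: is_root_def form_simple_self rho_generator simple_apply)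
  moreover have "s \<in> carrier W" using assms(2) S_carrier by auto
  ultimately show ?case by auto
next
  case (Cons r ss)
  let ?g = "list_prod W ss" and ?h = "list_prod W (r # ss)"
  let ?t = "?g \<otimes> s \<otimes> inv ?g"
  have r: "r \<in> S" "r \<in> carrier W" and sc: "s \<in> carrier W" and g: "?g \<in> carrier W"
    using Cons.prems assms(2) S_carrier by auto
  obtain b where b: "is_root ?t b" using Cons by auto
  have conj: "?h \<otimes> s \<otimes> inv ?h = r \<otimes> (?t \<otimes> r)"
    using r sc g by (simp add: inv_mult_group generator_inv m_assoc)
  have tc: "?t \<in> carrier W" using sc g by simp
  have "rho f (r \<otimes> (?t \<otimes> r)) v = reflect f (reflect 0 (simple r) b) v" for f v
  proof -
    have "rho f (r \<otimes> (?t \<otimes> r)) v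
        = reflect f (simple r) (reflect f b (reflect f (simple r) v))"
      using b r tc unfolding is_root_def by (simp only: rho_mult rho_generator m_closed)
    also have "\<dots> = reflect f (reflect 0 (simple r) b)
        (reflect f (simple r) (reflect f (simple r) v))"
      by (rule reflect_conjugate[OF form_simple_self[OF r(1)]])
    finally show ?thesis using r by (simp add: reflect_involution form_simple_self)
  qed
  moreover have "reflect 0 (simple r) b x = 0" if "x \<notin> S" for x
    using that r b by (auto simp: reflect_def vec_apply is_root_def simple_apply)
  ultimately have "is_root (r \<otimes> (?t \<otimes> r)) (reflect 0 (simple r) b)"
    using b r by (simp add: is_root_def form_reflect form_simple_self)
  then show ?case unfolding conj by blast
qed

lemma reflection_root: "t \<in> reflections W S \<Longrightarrow> \<exists>b. is_root t b"
  using generated conjugate_root unfolding reflections_def by blast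

definition root :: "'a \<Rightarrow> 'a \<Rightarrow> real" where
  "root t = (SOME b. is_root t b)"

lemma is_root_root: "t \<in> reflections W S \<Longrightarrow> is_root t (root t)"
  unfolding root_def using reflection_root by (rule someI_ex)

lemma reflections_carrier: "reflections W S \<subseteq> carrier W"
  using S_carrier by (auto simp: reflections_def)

lemma S_reflections: "S \<subseteq> reflections W S"
  using S_carrier unfolding reflections_def by (force intro: bexI[of _ \<one>])

text \<open>
  The corresponding orthogonal reflections of \<open>V\<close> commute, and the action on \<open>V\<close> is faithful.
\<close>

lemma orthogonal_commute:
  assumes "t \<in> reflections W S" "u \<in> reflections W S" "form (root t) (root u) = 0"
  shows "t \<otimes> u = u \<otimes> t"
proof (rule rho_injective)
  show "t \<otimes> u \<in> carrier W" "u \<otimes> t \<in> carrier W" using assms reflections_carrier by auto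
  fix v
  have "form (root u) (root t) = 0" using assms(3) by (simp add: form_sym)
  then show "rho 0 (t \<otimes> u) v = rho 0 (u \<otimes> t) v"
    using assms is_root_root[of t] is_root_root[of u] reflections_carrier
    by (simp add: rho_mult is_root_def subset_iff) (simp add: reflect_def algebra_simps)
qed

lemma rho_reflections:
  "set ts \<subseteq> reflections W S \<Longrightarrow> rho f (list_prod W ts) v = foldr (reflect f) (map root ts) v"
proof (induction ts)
  case (Cons t ts)
  then have "t \<in> carrier W" "set ts \<subseteq> carrier W" using reflections_carrier by auto
  with Cons is_root_root[of t] show ?case by (simp add: rho_mult is_root_def)
qed simp

section \<open>Short factorizations of a Coxeter element\<close>

lemma coxeter_element_surjective:
  assumes "coxeter_element W S c" "\<And>s. s \<notin> S \<Longrightarrow> u s = 0"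
  shows "\<exists>f. rho f c 0 = - u"
proof -
  obtain ss where "distinct ss" "set ss = S" "c = list_prod W ss"
    using assms(1) by (auto simp: coxeter_element_def)
  then show ?thesis using act_surjective[of ss u] assms(2) by (simp add: rho_list_prod)
qed

text \<open>
  Every vector of \<open>V\<close> is a displacement of \<open>c\<close>, and displacements lie in the span of the roots of any
  factorization; so at most \<open>|S|\<close> roots span a space of dimension \<open>|S|\<close>.
\<close>

lemma roots_independent:
  assumes c: "coxeter_element W S (list_prod W ts)"
    and ts: "set ts \<subseteq> reflections W S" and len: "length ts \<le> card S"
  shows "distinct (map root ts)" "vec.independent (set (map root ts))"
proof -
  let ?bs = "map root ts"
  have span: "simple ` S \<subseteq> vec.span (set ?bs)"
  proof safe
    fix s assume s: "s \<in> S"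
    then have "simple s r = 0" if "r \<notin> S" for r using that by (auto simp: simple_apply)
    then obtain f where "rho f (list_prod W ts) 0 = - simple s"
      using coxeter_element_surjective[OF c, of "simple s"] by blast
    then have "- simple s \<in> vec.span (set ?bs)"
      using foldr_reflect_span[of f ?bs 0] rho_reflections[OF ts] by simp
    then show "simple s \<in> vec.span (set ?bs)" using vec.span_neg by fastforce
  qed
  have bound: "card S \<le> card B" if "finite B" "simple ` S \<subseteq> vec.span B" for B
    using vec.independent_span_bound[OF that(1) independent_simple that(2)] by (simp add: card_simple)
  have card: "card (set ?bs) = length ?bs"
    using bound[OF _ span] len card_length[of ?bs] by auto
  then show "distinct ?bs" by (rule card_distinct)
  show "vec.independent (set ?bs)"
  proof
    assume "vec.dependent (set ?bs)"
    then obtain a where a: "a \<in> set ?bs" "a \<in> vec.span (set ?bs - {a})"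
      unfolding vec.dependent_def by blast
    then have "vec.span (set ?bs - {a}) = vec.span (set ?bs)"
      using vec.span_redundant[OF a(2)] by (simp add: insert_absorb)
    then have "card S \<le> card (set ?bs - {a})" using bound[of "set ?bs - {a}"] span by simp
    also have "\<dots> < card (set ?bs)" using a(1) by (intro card_Diff1_less) auto
    finally show False using card len by simp
  qed
qed

text \<open>
  The displacement of \<open>0\<close> is \<open>root t\<close>, so by independence its coordinates are \<open>1\<close> at \<open>root t\<close> and \<open>0\<close>
  elsewhere. The triangular formula for the vanishing coordinate at \<open>root u\<close> then yields \<open>f(root u)\<close>;
  it involves \<open>root t\<close> only if \<open>t\<close> stands to the right of \<open>u\<close>.
\<close>

lemma factorization_pairing:
  assumes c: "coxeter_element W S (list_prod W ts)"
    and ts: "set ts \<subseteq> reflections W S" "length ts \<le> card S"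
    and f: "rho f (list_prod W ts) 0 = - root t" and t: "t \<in> set ts" 
    and split: "ts = p @ u # q" and "u \<noteq> t"
  shows "pair f (root u) = (if t \<in> set q then 2 * form (root t) (root u) else 0)"
proof -
  let ?bs = "map root ts" and ?b = "root t"
  note indep = roots_independent[OF c ts]
  have inj: "inj_on root (set ts)" using indep(1) by (simp add: distinct_map)
  obtain x where x: "foldr (reflect f) ?bs 0 = 0 - (\<Sum>b\<in>set ?bs. scale (x b) b)"
    "\<And>p b q. ?bs = p @ b # q \<Longrightarrow> x b = pair f b + 2 * form (0 - (\<Sum>d\<in>set q. scale (x d) d)) b"
    using foldr_reflect_coordinates[OF indep(1), of f 0] by blast
  define e where "e b = (if b = ?b then 1 else 0 :: real)" for b
  have e_sum: "(\<Sum>b\<in>B. scale (e b) b) = (if ?b \<in> B then ?b else 0)" if "finite B" for B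
  proof -
    have "(\<Sum>b\<in>B. scale (e b) b) = (\<Sum>b\<in>B. if b = ?b then ?b else 0)"
      by (intro sum.cong) (auto simp: e_def)
    then show ?thesis using that by simp
  qed
  have "(\<Sum>b\<in>set ?bs. scale (x b) b) = ?b"
    using x(1) f rho_reflections[OF ts(1)] by simp
  also have "?b = (\<Sum>b\<in>set ?bs. scale (e b) b)"
    using e_sum[of "set ?bs"] t by simp
  finally have zero: "(\<Sum>b\<in>set ?bs. scale (x b - e b) b) = 0"
    by (simp add: vec.scale_left_diff_distrib sum_subtractf)
  have xe: "x b = e b" if "b \<in> set ?bs" for b
    using vec.independentD[OF indep(2) _ subset_refl zero that] by simp
  have "root u \<noteq> root t" using inj t split \<open>u \<noteq> t\<close> by (auto dest: inj_onD)
  then have "0 = x (root u)" using xe split by (simp add: e_def)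
  also have "\<dots> = pair f (root u) + 2 * form (0 - (\<Sum>d\<in>set (map root q). scale (x d) d)) (root u)"
    by (rule x(2)[of "map root p"]) (simp add: split)
  also have "(\<Sum>d\<in>set (map root q). scale (x d) d) = (\<Sum>d\<in>set (map root q). scale (e d) d)"
    using xe split by (intro sum.cong) auto
  also have "\<dots> = (if t \<in> set q then root t else 0)"
    using e_sum[of "set (map root q)"] inj t split by (auto dest: inj_onD)
  finally show ?thesis by (auto split: if_splits)
qed

text \<open>
  For one and the same functional \<open>f\<close> with displacement \<open>root b\<close>, the first factorization computes
  \<open>f(root a)\<close> as twice the inner product of the roots, the second as \<open>0\<close>.
\<close>

lemma inverted_commute:
  assumes c: "coxeter_element W S c"
    and ts: "set ts \<subseteq> reflections W S" "length ts \<le> card S" "c = list_prod W ts"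
    and us: "set us \<subseteq> reflections W S" "length us \<le> card S" "c = list_prod W us"
    and ab: "subseq [a, b] ts" and ba: "subseq [b, a] us"
  shows "a \<otimes> b = b \<otimes> a"
proof -
  obtain p q where p: "ts = p @ a # q" "b \<in> set q"
    using list_emb_ConsD[OF ab] by (auto simp: subseq_singleton_left)
  obtain p' r where "us = p' @ b # r" "a \<in> set r"
    using list_emb_ConsD[OF ba] by (auto simp: subseq_singleton_left)
  moreover from this(2) obtain q' q'' where "r = q' @ a # q''" by (auto dest: split_list)
  ultimately have q: "us = p' @ b # q' @ a # q''" by simp
  have "distinct us" using roots_independent(1)[of us] c us by (simp add: distinct_map)
  then have "b \<noteq> a" "b \<notin> set q''" using q by auto
  have a: "a \<in> reflections W S" and b: "b \<in> reflections W S" using p ts by auto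
  obtain f where f: "rho f c 0 = - root b"
    using coxeter_element_surjective[OF c, of "root b"] is_root_root[OF b] by (auto simp: is_root_def)
  have "pair f (root a) = 2 * form (root b) (root a)"
    using factorization_pairing[of ts f b p a q] c ts f p \<open>b \<noteq> a\<close> by auto
  moreover have "pair f (root a) = 0"
    using factorization_pairing[of us f b "p' @ b # q'" a q''] c us f q \<open>b \<noteq> a\<close> \<open>b \<notin> set q''\<close> by auto
  ultimately show ?thesis using orthogonal_commute[OF b a] by simp
qed

lemma T_reduced_exists:
  assumes "g \<in> carrier W"
  shows "\<exists>ts. T_reduced_expression W S g ts"
proof -
  let ?P = "\<lambda>k. \<exists>ts. set ts \<subseteq> reflections W S \<and> length ts = k \<and> list_prod W ts = g"
  obtain ss where "set ss \<subseteq> S" "list_prod W ss = g" using generated assms by blast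
  then have "?P (length ss)" using S_reflections by blast
  then have "?P (reflection_length W S g)" unfolding reflection_length_def by (rule LeastI)
  then show ?thesis unfolding T_reduced_expression_def by auto
qed

lemma coxeter_reflection_length:
  assumes "coxeter_element W S c"
  shows "reflection_length W S c \<le> card S"
proof -
  obtain ss where "distinct ss" "set ss = S" "c = list_prod W ss"
    using assms by (auto simp: coxeter_element_def)
  then show ?thesis unfolding reflection_length_def
    using S_reflections by (intro Least_le) (auto simp: distinct_card)
qed

text \<open>
  Append a reduced expression of \<open>x\<^sup>-\<^sup>1 c\<close>; the lengths add up to \<open>\<ell>\<^sub>T(c) \<le> |S|\<close>.
\<close>

lemma extend_reduced:
  assumes c: "coxeter_element W S c" and x: "x \<in> absolute_interval W S c"
    and ts: "T_reduced_expression W S x ts"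
  shows "\<exists>zs. set (ts @ zs) \<subseteq> reflections W S \<and> length (ts @ zs) \<le> card S \<and> c = list_prod W (ts @ zs)"
proof -
  have cc: "c \<in> carrier W" using c S_carrier by (auto simp: coxeter_element_def)
  have xc: "x \<in> carrier W" using x by (simp add: absolute_interval_def)
  obtain zs where zs: "T_reduced_expression W S (inv x \<otimes> c) zs"
    using T_reduced_exists[of "inv x \<otimes> c"] xc cc by auto
  have sets: "set ts \<subseteq> reflections W S" "set zs \<subseteq> reflections W S"
    using ts zs by (auto simp: T_reduced_expression_def)
  have "list_prod W (ts @ zs) = x \<otimes> (inv x \<otimes> c)"
    using sets reflections_carrier ts zs
    by (subst list_prod_append) (auto simp: T_reduced_expression_def)
  then have "c = list_prod W (ts @ zs)" using xc cc by (simp add: m_assoc[symmetric])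
  moreover have "length (ts @ zs) \<le> card S"
    using coxeter_reflection_length[OF c] x ts zs
    by (simp add: absolute_interval_def absolute_le_def T_reduced_expression_def)
  ultimately show ?thesis using sets by (intro exI[of _ zs]) auto
qed

end

theorem proposition1p3:
  fixes W :: "('a, 'b) monoid_scheme" and S :: "'a set" and c x y :: 'a and ts :: "'a list"
  assumes "coxeter_system W S"
    and "finite S"
    and "coxeter_element W S c"
    and "x \<in> absolute_interval W S c"
    and "T_reduced_expression W S x ts"
    and "y \<in> absolute_interval W S c"
    and "\<exists>us. T_reduced_expression W S y us \<and> set us = set ts"
  shows "x = y"
proof -
  obtain m where m: "coxeter_matrix S m" "presented_by W S (coxeter_relators S m)"
    using assms(1) by (auto simp: coxeter_system_def)
  then interpret coxeter_group W S m
    using assms(2)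
    by (simp add: coxeter_group_def coxeter_form_def coxeter_group_axioms_def presented_by_def)
  obtain us where us: "T_reduced_expression W S y us" "set us = set ts" using assms(7) by blast
  obtain vs where vs: "set (ts @ vs) \<subseteq> reflections W S" "length (ts @ vs) \<le> card S"
    "c = list_prod W (ts @ vs)"
    using extend_reduced[OF assms(3-5)] by blast
  obtain ws where ws: "set (us @ ws) \<subseteq> reflections W S" "length (us @ ws) \<le> card S"
    "c = list_prod W (us @ ws)"
    using extend_reduced[OF assms(3,6) us(1)] by blast
  have "list_prod W ts = list_prod W us"
  proof (rule list_prod_rearrangement)
    show "distinct ts" using roots_independent(1)[of "ts @ vs"] assms(3) vs by (simp add: distinct_map)
    show "distinct us" using roots_independent(1)[of "us @ ws"] assms(3) ws by (simp add: distinct_map)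
    show "set ts = set us" "set ts \<subseteq> carrier W" using us(2) vs(1) reflections_carrier by auto
    fix a b assume "subseq [a, b] ts" "subseq [b, a] us"
    then have "subseq [a, b] (ts @ vs)" "subseq [b, a] (us @ ws)" by (simp_all add: subseq_rev_drop_many)
    then show "a \<otimes>\<^bsub>W\<^esub> b = b \<otimes>\<^bsub>W\<^esub> a" by (rule inverted_commute[OF assms(3) vs ws])
  qed
  then show ?thesis using assms(5) us(1) by (simp add: T_reduced_expression_def)
qed

end
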